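(* Let $X$ be a completely regular space and let $H$ be a non-vanishing closed ideal in $C_B(X)$. The following are equivalent: (1) $\mathfrak{sp}(H)$ is extremally disconnected. (2) Every non-zero closed subideal of $H$ is an essential subideal of a direct summand of $H$.
   Context: Completely regular spaces are assumed to be Hausdorff. The scalar field $\mathbb{F}$ is either $\mathbb{R}$ or $\mathbb{C}$ and is fixed. For a space $X$, $C_B(X)$ is the Banach algebra of all bounded continuous mappings $X\to\mathbb{F}$ with pointwise addition and multiplication and the supremum norm. For completely regular $X$, $\beta X$ is the Stone–Čech compactification, and for $f\in C_B(X)$, $f_\beta$ denotes the unique continuous extension of $f$ to $\beta X$. The cozero-set of $f:Y\to\mathbb{F}$ is $\mathrm{Coz}(f)=\{y\in Y: f(y)\neq 0\}$. An ideal $H$ of $C_B(X)$ is non-vanishing if there is no point of $X$ at which every element of $H$ vanishes. For a non-vanishing closed ideal $H$, its spectrum is the subspace $\mathfrak{sp}(H)=\bigcup_{h\in H}\mathrm{Coz}(h_\beta)$ of $\beta X$. A subideal of an ideal $I$ of $C_B(X)$ is an ideal of $C_B(X)$ contained in $I$; a closed subideal is one that is closed in $C_B(X)$. A direct summand of $H$ is a subideal $J$ of $H$ such that $H=I\oplus J$ (internal direct sum) for some subideal $I$ of $H$ (possibly zero). A non-zero subideal of an ideal $I$ in a ring is essential if it has non-zero intersection with every non-zero subideal of $I$. A completely regular space $Y$ is extremally disconnected if the closure of every open subset of $Y$ is open. *)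

theory Defs
  imports "HOL-Analysis.Analysis" "HOL-Algebra.Ideal"
begin

no_notation Congruence.eq_closure_of ("closure'_of\<index>")

text \<open>
  Spaces are abstract topologies, and the scalar field is a type \<open>'k\<close>, to be instantiated
  with \<^typ>\<open>real\<close> and \<^typ>\<open>complex\<close>.
\<close>

section \<open>The algebra of bounded continuous functions\<close>

text \<open>
  The set of bounded continuous scalar functions with the supremum metric is the library's
  \<^term>\<open>cfunspace X euclidean_metric\<close>.  Its elements are extensional: they take the value
  \<^term>\<open>undefined\<close> off \<^term>\<open>topspace X\<close>, which the pointwise operations must preserve.
  An ideal of the ring is automatically closed under scalars, since constants lie in the ring.
\<close>

definition CB :: "'a topology \<Rightarrow> ('a \<Rightarrow> 'k::real_normed_field) ring" where
  "CB X = \<lparr>carrier = mspace (cfunspace X euclidean_metric),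
           monoid.mult = (\<lambda>f g. \<lambda>x\<in>topspace X. f x * g x),
           one = (\<lambda>x\<in>topspace X. 1),
           zero = (\<lambda>x\<in>topspace X. 0),
           add = (\<lambda>f g. \<lambda>x\<in>topspace X. f x + g x)\<rparr>"

lemma CB_simps [simp]:
  "carrier (CB X) = mspace (cfunspace X euclidean_metric)"
  "monoid.mult (CB X) f g = (\<lambda>x\<in>topspace X. f x * g x)"
  "\<one>\<^bsub>CB X\<^esub> = (\<lambda>x\<in>topspace X. 1)"
  "\<zero>\<^bsub>CB X\<^esub> = (\<lambda>x\<in>topspace X. 0)"
  "add (CB X) f g = (\<lambda>x\<in>topspace X. f x + g x)"
  by (simp_all add: CB_def)

lemma mem_CB_iff:
  "f \<in> carrier (CB X) \<longleftrightarrow>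
     f \<in> extensional (topspace X) \<and> continuous_map X euclidean f \<and> bounded (f ` topspace X)"
  by auto

lemma bounded_image_add:
  fixes f g :: "'a \<Rightarrow> 'k::real_normed_vector"
  assumes "bounded (f ` S)" "bounded (g ` S)"
  shows "bounded ((\<lambda>x. f x + g x) ` S)"
  using bounded_plus_comp[OF assms] .

lemma bounded_image_mult:
  fixes f g :: "'a \<Rightarrow> 'k::real_normed_field"
  assumes "bounded (f ` S)" "bounded (g ` S)"
  shows "bounded ((\<lambda>x. f x * g x) ` S)"
proof -
  obtain a b where "\<forall>x\<in>S. norm (f x) \<le> a" "\<forall>x\<in>S. norm (g x) \<le> b"
    using assms by (auto simp: bounded_iff)
  then have "\<forall>x\<in>S. norm (f x * g x) \<le> a * b"
    by (metis mult_mono' norm_ge_zero norm_mult)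
  then show ?thesis by (auto simp: bounded_iff)
qed

lemma CB_memI:
  assumes "continuous_map X euclidean f" "bounded (f ` topspace X)"
  shows "restrict f (topspace X) \<in> carrier (CB X)"
  unfolding mem_CB_iff
proof (intro conjI)
  show "continuous_map X euclidean (restrict f (topspace X))"
    using assms(1) by (rule continuous_map_eq) simp
qed (use assms in simp_all)

lemma cring_CB: "cring (CB X :: ('a \<Rightarrow> 'k::real_normed_field) ring)"
proof (rule cringI)
  let ?R = "CB X :: ('a \<Rightarrow> 'k) ring"
  have neg: "\<exists>g\<in>carrier ?R. g \<oplus>\<^bsub>?R\<^esub> f = \<zero>\<^bsub>?R\<^esub>" if "f \<in> carrier ?R" for f
  proof (rule bexI)
    have f: "continuous_map X euclidean f" "bounded (f ` topspace X)"
      using that unfolding mem_CB_iff by auto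
    then obtain b where "\<forall>x\<in>topspace X. norm (f x) \<le> b"
      by (auto simp: bounded_iff)
    then have "bounded ((\<lambda>x. - f x) ` topspace X)"
      by (auto simp: bounded_iff)
    moreover have "continuous_map X euclidean (\<lambda>x. - f x)"
      using f by (intro continuous_intros)
    ultimately show "(\<lambda>x\<in>topspace X. - f x) \<in> carrier ?R"
      by (intro CB_memI)
    show "(\<lambda>x\<in>topspace X. - f x) \<oplus>\<^bsub>?R\<^esub> f = \<zero>\<^bsub>?R\<^esub>"
      by (auto simp: fun_eq_iff)
  qed
  have cl: "f \<oplus>\<^bsub>?R\<^esub> g \<in> carrier ?R" "f \<otimes>\<^bsub>?R\<^esub> g \<in> carrier ?R"
    if "f \<in> carrier ?R" "g \<in> carrier ?R" for f g
  proof -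
    have f: "continuous_map X euclidean f" "bounded (f ` topspace X)"
      and g: "continuous_map X euclidean g" "bounded (g ` topspace X)"
      using that unfolding mem_CB_iff by auto
    have "(\<lambda>x\<in>topspace X. f x + g x) \<in> carrier ?R"
      using f g by (intro CB_memI bounded_image_add continuous_intros)
    then show "f \<oplus>\<^bsub>?R\<^esub> g \<in> carrier ?R" unfolding CB_simps(5) .
    have "continuous_map X euclidean (\<lambda>x. f x * g x)"
      using f g by (simp add: continuous_map_atin tendsto_mult)
    then have "(\<lambda>x\<in>topspace X. f x * g x) \<in> carrier ?R"
      using f g by (intro CB_memI bounded_image_mult)
    then show "f \<otimes>\<^bsub>?R\<^esub> g \<in> carrier ?R" unfolding CB_simps(2) .
  qed
  have c: "(\<lambda>x\<in>topspace X. c) \<in> carrier ?R" for c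
    by (intro CB_memI) (auto simp: bounded_iff)
  have ext: "restrict f (topspace X) = f" if "f \<in> carrier ?R" for f
    using that unfolding mem_CB_iff by (blast intro: extensional_restrict)
  show "abelian_group ?R"
  proof (rule abelian_groupI)
    show "\<zero>\<^bsub>?R\<^esub> \<in> carrier ?R" using c unfolding CB_simps(4) .
    fix f g h assume f: "f \<in> carrier ?R" and g: "g \<in> carrier ?R" and "h \<in> carrier ?R"
    show "f \<oplus>\<^bsub>?R\<^esub> g \<in> carrier ?R" using f g by (rule cl)
    show "f \<oplus>\<^bsub>?R\<^esub> g \<oplus>\<^bsub>?R\<^esub> h = f \<oplus>\<^bsub>?R\<^esub> (g \<oplus>\<^bsub>?R\<^esub> h)"
      unfolding CB_simps(5) by (rule restrict_ext) (simp add: add.assoc)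
    show "f \<oplus>\<^bsub>?R\<^esub> g = g \<oplus>\<^bsub>?R\<^esub> f"
      unfolding CB_simps(5) by (rule restrict_ext) (rule add.commute)
    have "\<zero>\<^bsub>?R\<^esub> \<oplus>\<^bsub>?R\<^esub> f = restrict f (topspace X)"
      unfolding CB_simps(4,5) by (rule restrict_ext) simp
    then show "\<zero>\<^bsub>?R\<^esub> \<oplus>\<^bsub>?R\<^esub> f = f" using ext[OF f] by (rule trans)
    show "\<exists>k\<in>carrier ?R. k \<oplus>\<^bsub>?R\<^esub> f = \<zero>\<^bsub>?R\<^esub>" using f by (rule neg)
  qed
  show "Group.comm_monoid ?R"
  proof (rule comm_monoidI)
    show "\<one>\<^bsub>?R\<^esub> \<in> carrier ?R" using c unfolding CB_simps(3) .
    fix f g h assume f: "f \<in> carrier ?R" and g: "g \<in> carrier ?R" and "h \<in> carrier ?R"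
    show "f \<otimes>\<^bsub>?R\<^esub> g \<in> carrier ?R" using f g by (rule cl)
    show "f \<otimes>\<^bsub>?R\<^esub> g \<otimes>\<^bsub>?R\<^esub> h = f \<otimes>\<^bsub>?R\<^esub> (g \<otimes>\<^bsub>?R\<^esub> h)"
      unfolding CB_simps(2) by (rule restrict_ext) (simp add: mult.assoc)
    show "f \<otimes>\<^bsub>?R\<^esub> g = g \<otimes>\<^bsub>?R\<^esub> f"
      unfolding CB_simps(2) by (rule restrict_ext) (rule mult.commute)
    have "\<one>\<^bsub>?R\<^esub> \<otimes>\<^bsub>?R\<^esub> f = restrict f (topspace X)"
      unfolding CB_simps(2,3) by (rule restrict_ext) simp
    then show "\<one>\<^bsub>?R\<^esub> \<otimes>\<^bsub>?R\<^esub> f = f" using ext[OF f] by (rule trans)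
  qed
  fix f g h
  show "(f \<oplus>\<^bsub>?R\<^esub> g) \<otimes>\<^bsub>?R\<^esub> h = f \<otimes>\<^bsub>?R\<^esub> h \<oplus>\<^bsub>?R\<^esub> g \<otimes>\<^bsub>?R\<^esub> h"
    unfolding CB_simps(2,5) by (rule restrict_ext) (simp add: distrib_right)
qed


section \<open>Ideals\<close>

definition closed_ideal :: "('a \<Rightarrow> 'k::real_normed_field) set \<Rightarrow> 'a topology \<Rightarrow> bool" where
  "closed_ideal H X \<longleftrightarrow>
     ideal H (CB X) \<and> closedin (mtopology_of (cfunspace X euclidean_metric)) H"

definition non_vanishing :: "('a \<Rightarrow> 'k::real_normed_field) set \<Rightarrow> 'a topology \<Rightarrow> bool" where
  "non_vanishing H X \<longleftrightarrow> (\<forall>x\<in>topspace X. \<exists>h\<in>H. h x \<noteq> 0)"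

definition subideal :: "'r set \<Rightarrow> 'r set \<Rightarrow> ('r, 'm) ring_scheme \<Rightarrow> bool" where
  "subideal J I R \<longleftrightarrow> ideal J R \<and> J \<subseteq> I"

definition direct_summand :: "'r set \<Rightarrow> 'r set \<Rightarrow> ('r, 'm) ring_scheme \<Rightarrow> bool" where
  "direct_summand J H R \<longleftrightarrow> subideal J H R \<and>
     (\<exists>I. subideal I H R \<and> H = I <+>\<^bsub>R\<^esub> J \<and> I \<inter> J = {\<zero>\<^bsub>R\<^esub>})"

definition essential_subideal :: "'r set \<Rightarrow> 'r set \<Rightarrow> ('r, 'm) ring_scheme \<Rightarrow> bool" where
  "essential_subideal K I R \<longleftrightarrow> subideal K I R \<and> K \<noteq> {\<zero>\<^bsub>R\<^esub>} \<and>
     (\<forall>L. subideal L I R \<and> L \<noteq> {\<zero>\<^bsub>R\<^esub>} \<longrightarrow> K \<inter> L \<noteq> {\<zero>\<^bsub>R\<^esub>})"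


section \<open>The Stone--Cech compactification\<close>

text \<open>
  For completely regular Hausdorff \<open>X\<close>, the Stone--Cech compactification is realised as the
  closure of the image of \<open>X\<close> under the evaluation map into the cube indexed by all continuous
  functions from \<open>X\<close> to the unit interval.  The point \<open>x\<close> of \<open>X\<close> is represented in it by
  \<open>beta_emb X x\<close>.  The lemmas below establish the characteristic properties.
\<close>

definition unit_functions :: "'a topology \<Rightarrow> ('a \<Rightarrow> real) set" where
  "unit_functions X =
     mspace (submetric (cfunspace X euclidean_metric) {f. f \<in> topspace X \<rightarrow> {0..1}})"

definition beta_cube :: "'a topology \<Rightarrow> (('a \<Rightarrow> real) \<Rightarrow> real) topology" where
  "beta_cube X = product_topology (\<lambda>f. top_of_set {0..1}) (unit_functions X)"

definition beta_emb :: "'a topology \<Rightarrow> 'a \<Rightarrow> ('a \<Rightarrow> real) \<Rightarrow> real" where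
  "beta_emb X x = (\<lambda>f\<in>unit_functions X. f x)"

definition beta :: "'a topology \<Rightarrow> (('a \<Rightarrow> real) \<Rightarrow> real) topology" where
  "beta X = subtopology (beta_cube X) (beta_cube X closure_of (beta_emb X ` topspace X))"

definition is_beta_extension ::
    "'a topology \<Rightarrow> ('a \<Rightarrow> 'k::real_normed_field) \<Rightarrow> ((('a \<Rightarrow> real) \<Rightarrow> real) \<Rightarrow> 'k) \<Rightarrow> bool" where
  "is_beta_extension X f g \<longleftrightarrow>
     g \<in> extensional (topspace (beta X)) \<and> continuous_map (beta X) euclidean g \<and>
     (\<forall>x\<in>topspace X. g (beta_emb X x) = f x)"

definition beta_ext ::
    "'a topology \<Rightarrow> ('a \<Rightarrow> 'k::real_normed_field) \<Rightarrow> (('a \<Rightarrow> real) \<Rightarrow> real) \<Rightarrow> 'k" where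
  "beta_ext X f = (THE g. is_beta_extension X f g)"

lemma beta_emb_in_cube: "beta_emb X ` topspace X \<subseteq> topspace (beta_cube X)"
proof (intro image_subsetI)
  fix x assume "x \<in> topspace X"
  then have "f x \<in> {0..1}" if "f \<in> unit_functions X" for f
    using that unfolding unit_functions_def mspace_submetric by blast
  then show "beta_emb X x \<in> topspace (beta_cube X)"
    unfolding beta_cube_def beta_emb_def by (simp add: PiE_iff)
qed

lemma topspace_beta:
  "topspace (beta X) = beta_cube X closure_of (beta_emb X ` topspace X)"
  unfolding beta_def by (rule topspace_subtopology_subset[OF closure_of_subset_topspace])

lemma beta_emb_in_beta: "x \<in> topspace X \<Longrightarrow> beta_emb X x \<in> topspace (beta X)"
  unfolding topspace_beta using closure_of_subset[OF beta_emb_in_cube, of X] by blast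

lemma compact_space_beta: "compact_space (beta X)"
proof -
  have "compact_space (beta_cube X)"
    by (simp add: beta_cube_def compact_space_product_topology compact_space_subtopology)
  then show ?thesis
    unfolding beta_def by (intro compact_space_subtopology closedin_compact_space) auto
qed

lemma Hausdorff_space_beta: "Hausdorff_space (beta X)"
proof -
  have "Hausdorff_space (beta_cube X)"
    unfolding beta_cube_def Hausdorff_space_product_topology
    by (simp add: Hausdorff_space_subtopology)
  then show ?thesis
    unfolding beta_def by (rule Hausdorff_space_subtopology)
qed

lemma embedding_map_beta_emb:
  assumes "completely_regular_space X" "Hausdorff_space X"
  shows "embedding_map X (beta X) (beta_emb X)"
proof -
  have "embedding_map X (beta_cube X) (beta_emb X)"
    using completely_regular_space_cube_embedding_explicit[OF assms]
    by (simp only: beta_cube_def beta_emb_def[abs_def] unit_functions_def)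
  then show ?thesis
    unfolding beta_def embedding_map_in_subtopology
    using closure_of_subset[OF beta_emb_in_cube, of X] by blast
qed

lemma dense_beta_emb: "beta X closure_of (beta_emb X ` topspace X) = topspace (beta X)"
proof -
  let ?A = "beta_emb X ` topspace X"
  have "?A \<subseteq> beta_cube X closure_of ?A"
    by (rule closure_of_subset[OF beta_emb_in_cube])
  then have "beta X closure_of ?A = beta_cube X closure_of ?A \<inter> beta_cube X closure_of ?A"
    unfolding beta_def by (simp add: closure_of_subtopology Int_absorb1)
  then show ?thesis by (simp add: topspace_beta)
qed

lemma beta_extension_unique:
  assumes "is_beta_extension X f g" "is_beta_extension X f h"
  shows "g = h"
proof (rule extensionalityI)
  show "g \<in> extensional (topspace (beta X))" "h \<in> extensional (topspace (beta X))"
    using assms by (auto simp: is_beta_extension_def)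
  fix p assume "p \<in> topspace (beta X)"
  then show "g p = h p"
    using assms forall_in_closure_of_eq[of p "beta X" "beta_emb X ` topspace X" euclidean g h]
    unfolding dense_beta_emb is_beta_extension_def by fastforce
qed

lemma beta_extension_exists_real:
  fixes f :: "'a \<Rightarrow> real"
  assumes "continuous_map X euclidean f" "bounded (f ` topspace X)"
  obtains g where "continuous_map (beta X) euclidean g" "\<forall>x\<in>topspace X. g (beta_emb X x) = f x"
proof -
  obtain M where M: "M > 0" "\<And>x. x \<in> topspace X \<Longrightarrow> \<bar>f x\<bar> \<le> M"
    using assms(2) by (auto simp: bounded_pos)
  define u where "u = (\<lambda>x\<in>topspace X. (f x + M) / (2 * M))"
  have r: "(f x + M) / (2 * M) \<in> {0..1}" if "x \<in> topspace X" for x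
    using M(1) M(2)[OF that] by (auto simp: field_simps)
  have "u \<in> carrier (CB X)" unfolding u_def
  proof (rule CB_memI)
    show "continuous_map X euclidean (\<lambda>x. (f x + M) / (2 * M))"
      using assms M(1) by (intro continuous_intros) auto
    show "bounded ((\<lambda>x. (f x + M) / (2 * M)) ` topspace X)"
      using r by (intro bounded_subset[OF bounded_closed_interval[of 0 1]]) auto
  qed
  moreover have "u \<in> topspace X \<rightarrow> {0..1}"
    using r unfolding u_def by fastforce
  ultimately have u: "u \<in> unit_functions X"
    unfolding unit_functions_def mspace_submetric CB_simps(1) by blast
  have "continuous_map (beta_cube X) (top_of_set {0..1}) (\<lambda>p. p u)"
    unfolding beta_cube_def using u by (rule continuous_map_product_projection)
  then have "continuous_map (beta X) euclidean (\<lambda>p. p u)"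
    unfolding beta_def
    by (intro continuous_map_from_subtopology) (simp add: continuous_map_in_subtopology)
  then have "continuous_map (beta X) euclidean (\<lambda>p. 2 * M * p u - M)"
    by (intro continuous_intros)
  moreover have "\<forall>x\<in>topspace X. 2 * M * beta_emb X x u - M = f x"
  proof
    fix x assume x: "x \<in> topspace X"
    have "beta_emb X x u = (f x + M) / (2 * M)"
      using u x by (simp add: beta_emb_def u_def)
    then show "2 * M * beta_emb X x u - M = f x"
      using M(1) by (simp add: field_simps)
  qed
  ultimately show ?thesis using that by blast
qed

lemma beta_extension_exists:
  fixes f :: "'a \<Rightarrow> 'k::{real_normed_field, euclidean_space}"
  assumes "f \<in> carrier (CB X)"
  shows "is_beta_extension X f (beta_ext X f)"
proof -
  have f: "continuous_map X euclidean f" "bounded (f ` topspace X)"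
    using assms unfolding mem_CB_iff by auto
  have "\<exists>g. continuous_map (beta X) euclidean g \<and> (\<forall>x\<in>topspace X. g (beta_emb X x) = f x \<bullet> b)"
    for b
  proof -
    have "continuous_map X euclidean (\<lambda>x. f x \<bullet> b)"
      using f(1) by (simp add: continuous_map_atin tendsto_inner)
    moreover have "bounded ((\<lambda>x. f x \<bullet> b) ` topspace X)"
      using bounded_linear_image[OF f(2) bounded_linear_inner_left[of b]]
      by (simp add: image_image)
    ultimately show ?thesis
      using beta_extension_exists_real by metis
  qed
  then obtain G where G: "\<And>b. continuous_map (beta X) euclidean (G b)"
      "\<And>b x. x \<in> topspace X \<Longrightarrow> G b (beta_emb X x) = f x \<bullet> b"
    by metis
  define g where "g = (\<lambda>p. \<Sum>b\<in>Basis. G b p *\<^sub>R b)"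
  have "continuous_map (beta X) euclidean g"
    using G(1) unfolding g_def continuous_map_atin limitin_canonical_iff
    by (auto intro!: tendsto_sum tendsto_scaleR)
  then have "continuous_map (beta X) euclidean (restrict g (topspace (beta X)))"
    by (rule continuous_map_eq) simp
  moreover have "\<forall>x\<in>topspace X. g (beta_emb X x) = f x"
    by (simp add: g_def G(2) euclidean_representation)
  ultimately have "is_beta_extension X f (restrict g (topspace (beta X)))"
    by (simp add: is_beta_extension_def beta_emb_in_beta)
  then show ?thesis
    unfolding beta_ext_def by (metis beta_extension_unique theI)
qed


section \<open>The spectrum\<close>

definition Coz :: "'b topology \<Rightarrow> ('b \<Rightarrow> 'k::zero) \<Rightarrow> 'b set" where
  "Coz Y f = {y \<in> topspace Y. f y \<noteq> 0}"

definition spectrum ::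
    "('a \<Rightarrow> 'k::real_normed_field) set \<Rightarrow> 'a topology \<Rightarrow> (('a \<Rightarrow> real) \<Rightarrow> real) topology" where
  "spectrum H X = subtopology (beta X) (\<Union>h\<in>H. Coz (beta X) (beta_ext X h))"

text \<open>
  Used for completely regular Hausdorff spaces only; every spectrum is one, being a subspace of
  a compact Hausdorff space.
\<close>

definition extremally_disconnected :: "'b topology \<Rightarrow> bool" where
  "extremally_disconnected Y \<longleftrightarrow> (\<forall>U. openin Y U \<longrightarrow> openin Y (Y closure_of U))"

end

theory Submission
  imports Defs
begin

text \<open>
  The Stone--Cech compactification can be eliminated at once.  Non-vanishing of \<open>H\<close> says that
  the spectrum contains the image of \<open>X\<close>, and any space lying between \<open>X\<close> and its
  Stone--Cech compactification is extremally disconnected exactly when \<open>X\<close> is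
  (\<open>extremally_disconnected_between_iff\<close>): going down, because \<open>X\<close> is dense; going up, because
  characteristic functions of clopen subsets of \<open>X\<close> extend continuously.  So the claim is one about
  \<open>X\<close> alone.

  In \<open>X\<close>, attach to an ideal \<open>K\<close> the open set \<open>coz K\<close> (\<open>ideal_coz X K\<close> below) of points
  at which some element of \<open>K\<close> does not vanish.  Two dictionary entries turn the algebra into topology.  A non-zero subideal \<open>K\<close> of \<open>J\<close> is
  essential iff \<open>coz K\<close> is dense in \<open>coz J\<close> (\<open>essential_subideal_iff\<close>).  Direct summands of \<open>H\<close>
  correspond to clopen sets: if \<open>H = I \<oplus> J\<close> then products of elements of \<open>I\<close> and \<open>J\<close> lie in
  \<open>I \<inter> J = 0\<close>, so \<open>coz I\<close> and \<open>coz J\<close> are disjoint open sets, and they cover \<open>X\<close> because \<open>H\<close> is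
  non-vanishing (\<open>direct_summand_coz_clopen\<close>); conversely a clopen set splits \<open>H\<close> by multiplication
  with its characteristic function (\<open>direct_summand_vanishing_off\<close>).  Thus condition (2) says that
  each \<open>coz K\<close> is dense in some clopen set, which must be its closure; and
  since \<open>X\<close> is completely regular and \<open>H\<close> non-vanishing, every open set is \<open>coz K\<close> for the closed
  subideal \<open>K\<close> of all elements of \<open>H\<close> that vanish off it (\<open>ideal_coz_vanishing_off\<close>).
\<close>

section \<open>Spaces between a space and its Stone--Cech compactification\<close>

lemma CB_indicator:
  assumes "openin X V" "closedin X V"
  shows "(\<lambda>x\<in>topspace X. if x \<in> V then 1 else 0 :: 'k::real_normed_field) \<in> carrier (CB X)"
proof (rule CB_memI)
  have "openin X {x \<in> topspace X. (if x \<in> V then 1 else 0 :: 'k) \<in> N}" for N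
  proof -
    have "{x \<in> topspace X. (if x \<in> V then 1 else 0 :: 'k) \<in> N} =
        (if 1 \<in> N then V else {}) \<union> (if 0 \<in> N then topspace X - V else {})"
      using openin_subset[OF assms(1)] by auto
    then show ?thesis
      using assms by (auto intro: openin_diff)
  qed
  then show "continuous_map X euclidean (\<lambda>x. if x \<in> V then 1 else 0 :: 'k)"
    by (simp add: continuous_map_def)
  show "bounded ((\<lambda>x. if x \<in> V then 1 else 0 :: 'k) ` topspace X)"
    by (auto simp: bounded_iff intro!: exI[of _ 1])
qed

text \<open>
  Going down, an open \<open>U\<close> of \<open>X\<close> is the trace of an open \<open>A\<close> of the larger space, and by density
  the closure of \<open>U\<close> is the trace of the closure of \<open>A\<close>.  Going up, let \<open>V\<close> be the closure in \<open>X\<close>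
  of the trace of \<open>A\<close>; it is clopen, so its characteristic function extends to a continuous \<open>g\<close>,
  and the closure of \<open>A\<close> is the open set where \<open>g\<close> does not vanish.
\<close>

lemma extremally_disconnected_between_iff:
  assumes X: "completely_regular_space X" "Hausdorff_space X"
    and T: "beta_emb X ` topspace X \<subseteq> T" "T \<subseteq> topspace (beta X)"
  shows "extremally_disconnected (subtopology (beta X) T) \<longleftrightarrow> extremally_disconnected X"
proof
  let ?e = "beta_emb X" and ?Y = "subtopology (beta X) T"
  have topY: "topspace ?Y = T"
    using T(2) by (simp add: Int_absorb1)
  have emb: "embedding_map X ?Y ?e"
    using embedding_map_beta_emb[OF X] T by (simp add: embedding_map_in_subtopology)
  have ce: "continuous_map X ?Y ?e"
    using emb homeomorphic_imp_continuous_map continuous_map_in_subtopology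
    unfolding embedding_map_def by blast
  have preopen: "openin X {x \<in> topspace X. ?e x \<in> A}" if "openin ?Y A" for A
    using openin_continuous_map_preimage[OF ce that] .
  have meets: "\<exists>x\<in>topspace X. ?e x \<in> A" if A: "openin ?Y A" "A \<noteq> {}" for A
  proof -
    obtain B where B: "openin (beta X) B" "A = B \<inter> T"
      using A(1) by (auto simp: openin_subtopology)
    obtain p where "p \<in> B"
      using A B by blast
    then have "p \<in> beta X closure_of (?e ` topspace X)"
      using openin_subset[OF B(1)] dense_beta_emb[of X] by auto
    then obtain x where "x \<in> topspace X" "?e x \<in> B"
      using B(1) \<open>p \<in> B\<close> unfolding in_closure_of by blast
    then show ?thesis
      using B(2) T(1) by blast
  qed
  have trace: "\<exists>A. openin ?Y A \<and> (\<forall>x\<in>topspace X. ?e x \<in> A \<longleftrightarrow> x \<in> U)" if U: "openin X U" for U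
  proof -
    have hom: "homeomorphic_map X (subtopology ?Y (?e ` topspace X)) ?e"
      using emb unfolding embedding_map_def .
    have inj: "inj_on ?e (topspace X)"
      using hom by (rule homeomorphic_imp_injective_map)
    have "openin (subtopology ?Y (?e ` topspace X)) (?e ` U)"
      using homeomorphic_imp_open_map[OF hom] U unfolding open_map_def by simp
    then obtain A where A: "openin ?Y A" "?e ` U = A \<inter> ?e ` topspace X"
      unfolding openin_subtopology[of ?Y] by metis
    have "?e x \<in> A \<longleftrightarrow> x \<in> U" if x: "x \<in> topspace X" for x
      using A(2) x inj_on_image_mem_iff[OF inj x openin_subset[OF U]] by blast
    then show ?thesis
      using A(1) by blast
  qed
  show "extremally_disconnected X" if ed: "extremally_disconnected ?Y"
    unfolding extremally_disconnected_def
  proof (intro allI impI)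
    fix U assume U: "openin X U"
    then obtain A where A: "openin ?Y A" and AU: "\<And>x. x \<in> topspace X \<Longrightarrow> ?e x \<in> A \<longleftrightarrow> x \<in> U"
      using trace by metis
    have UA: "?e ` U \<subseteq> A"
      using AU openin_subset[OF U] by blast
    have "X closure_of U = {x \<in> topspace X. ?e x \<in> ?Y closure_of A}"
    proof (intro subset_antisym subsetI CollectI conjI)
      fix x assume x: "x \<in> X closure_of U"
      then show "x \<in> topspace X"
        by (simp add: in_closure_of)
      have "?e x \<in> ?Y closure_of (?e ` U)"
        using continuous_map_image_closure_subset[OF ce] x by blast
      then show "?e x \<in> ?Y closure_of A"
        using closure_of_mono[OF UA, of ?Y] by blast
    next
      fix x assume "x \<in> {x \<in> topspace X. ?e x \<in> ?Y closure_of A}"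
      then have x: "x \<in> topspace X" "?e x \<in> ?Y closure_of A"
        by auto
      show "x \<in> X closure_of U"
        unfolding in_closure_of
      proof (intro conjI allI impI x(1))
        fix W assume W: "x \<in> W \<and> openin X W"
        then obtain B where B: "openin ?Y B" "\<And>z. z \<in> topspace X \<Longrightarrow> ?e z \<in> B \<longleftrightarrow> z \<in> W"
          using trace by metis
        then have "A \<inter> B \<noteq> {}"
          using x W unfolding in_closure_of by blast
        then obtain z where "z \<in> topspace X" "?e z \<in> A \<inter> B"
          using meets[of "A \<inter> B"] A B(1) by blast
        then show "\<exists>y. y \<in> U \<and> y \<in> W"
          using AU B(2) by blast
      qed
    qed
    moreover have "openin ?Y (?Y closure_of A)"
      using ed A unfolding extremally_disconnected_def by blast
    ultimately show "openin X (X closure_of U)"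
      using preopen by metis
  qed
  show "extremally_disconnected ?Y" if ed: "extremally_disconnected X"
    unfolding extremally_disconnected_def
  proof (intro allI impI)
    fix A assume A: "openin ?Y A"
    define V where "V = X closure_of {x \<in> topspace X. ?e x \<in> A}"
    have V: "openin X V" "closedin X V"
      using ed preopen[OF A] unfolding V_def extremally_disconnected_def by auto
    obtain g where g: "continuous_map (beta X) euclidean g"
        "\<forall>x\<in>topspace X. g (?e x) = (\<lambda>x\<in>topspace X. if x \<in> V then 1 else 0 :: real) x"
      using CB_indicator[OF V, where 'k = real] beta_extension_exists_real
      unfolding mem_CB_iff by metis
    have gY: "continuous_map ?Y euclidean g"
      using g(1) by (rule continuous_map_from_subtopology)
    have pre: "openin ?Y {p \<in> T. g p \<in> N}" if "open N" for N
      using openin_continuous_map_preimage[OF gY, of N] that unfolding topY by simp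
    \<comment> \<open>The closure of \<open>A\<close> is squeezed between \<open>{g \<noteq> 0}\<close> and the smaller closed set \<open>{g = 1}\<close>.\<close>
    have "A \<subseteq> {p \<in> T. g p = 1}"
    proof -
      have "x \<in> V" if "x \<in> topspace X" "?e x \<in> A" for x
        using that closure_of_subset[of "{x \<in> topspace X. ?e x \<in> A}" X] unfolding V_def by blast
      then have "\<not> (\<exists>x\<in>topspace X. ?e x \<in> A \<inter> {p \<in> T. g p \<in> - {1}})"
        using g(2) by auto
      moreover have "openin ?Y (A \<inter> {p \<in> T. g p \<in> - {1}})"
        using A pre[of "- {1}"] by (intro openin_Int) (auto simp: open_Compl)
      ultimately have "A \<inter> {p \<in> T. g p \<in> - {1}} = {}"
        using meets by blast
      then show ?thesis
        using openin_subset[OF A] topY by auto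
    qed
    moreover have "closedin ?Y {p \<in> T. g p = 1}"
      using closedin_continuous_map_preimage[OF gY, of "{1}"] unfolding topY by simp
    ultimately have up: "?Y closure_of A \<subseteq> {p \<in> T. g p = 1}"
      by (rule closure_of_minimal)
    have "p \<in> ?Y closure_of A" if p: "p \<in> T" "g p \<noteq> 0" for p
      unfolding in_closure_of topY
    proof (intro conjI allI impI p(1))
      fix B assume B: "p \<in> B \<and> openin ?Y B"
      have "openin ?Y (B \<inter> {p \<in> T. g p \<in> - {0}})"
        using B pre[of "- {0}"] by (intro openin_Int) (auto simp: open_Compl)
      then obtain x where x: "x \<in> topspace X" "?e x \<in> B" "g (?e x) \<noteq> 0"
        using meets[of "B \<inter> {p \<in> T. g p \<in> - {0}}"] p B by auto
      then have "x \<in> V"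
        using g(2) by (auto split: if_splits)
      then have "\<forall>W. x \<in> W \<and> openin X W \<longrightarrow> (\<exists>z. z \<in> {x \<in> topspace X. ?e x \<in> A} \<and> z \<in> W)"
        unfolding V_def in_closure_of by (rule conjunct2)
      then obtain z where "z \<in> {x \<in> topspace X. ?e x \<in> A}" "z \<in> {x \<in> topspace X. ?e x \<in> B}"
        using x(1,2) preopen[of B] B by (metis (no_types, lifting) mem_Collect_eq)
      then show "\<exists>y. y \<in> A \<and> y \<in> B"
        by blast
    qed
    then have "?Y closure_of A = {p \<in> T. g p \<in> - {0}}"
      using up by auto
    then show "openin ?Y (?Y closure_of A)"
      using pre[of "- {0}"] by (simp add: open_Compl)
  qed
qed

lemma extremally_disconnected_spectrum_iff:
  fixes H :: "('a \<Rightarrow> 'k::{real_normed_field, euclidean_space}) set"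
  assumes "completely_regular_space X" "Hausdorff_space X"
    and "ideal H (CB X)" "non_vanishing H X"
  shows "extremally_disconnected (spectrum H X) \<longleftrightarrow> extremally_disconnected X"
  unfolding spectrum_def
proof (rule extremally_disconnected_between_iff[OF assms(1,2)])
  show "beta_emb X ` topspace X \<subseteq> (\<Union>h\<in>H. Coz (beta X) (beta_ext X h))"
  proof (intro image_subsetI)
    fix x assume x: "x \<in> topspace X"
    then obtain h where h: "h \<in> H" "h x \<noteq> 0"
      using assms(4) unfolding non_vanishing_def by blast
    then have "is_beta_extension X h (beta_ext X h)"
      using beta_extension_exists ideal.Icarr[OF assms(3)] by blast
    then show "beta_emb X x \<in> (\<Union>h\<in>H. Coz (beta X) (beta_ext X h))"
      using x h beta_emb_in_beta unfolding is_beta_extension_def Coz_def by fastforce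
  qed
qed (auto simp: Coz_def)


section \<open>Ideals and their cozero-sets\<close>

\<comment> \<open>Ring facts are stated for the carrier, which the simplifier should therefore not unfold.\<close>
declare CB_simps(1) [simp del]

lemma CB_eq_zero_iff:
  assumes "f \<in> carrier (CB X)"
  shows "f = \<zero>\<^bsub>CB X\<^esub> \<longleftrightarrow> (\<forall>x\<in>topspace X. f x = 0)"
  using assms unfolding mem_CB_iff by (auto simp: fun_eq_iff extensional_def)

lemma (in cring) ideal_iff_closed:
  "ideal S R \<longleftrightarrow> S \<subseteq> carrier R \<and> S \<noteq> {} \<and> (\<forall>a\<in>S. \<forall>b\<in>S. a \<oplus> b \<in> S) \<and>
     (\<forall>a\<in>S. \<forall>r\<in>carrier R. r \<otimes> a \<in> S)"
proof (intro iffI conjI)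
  assume S: "S \<subseteq> carrier R \<and> S \<noteq> {} \<and> (\<forall>a\<in>S. \<forall>b\<in>S. a \<oplus> b \<in> S) \<and>
     (\<forall>a\<in>S. \<forall>r\<in>carrier R. r \<otimes> a \<in> S)"
  have "\<ominus> a \<in> S" if "a \<in> S" for a
  proof -
    have "\<ominus> \<one> \<otimes> a \<in> S" "a \<in> carrier R"
      using S that by auto
    then show ?thesis
      by (simp add: l_minus)
  qed
  then have "subgroup S (add_monoid R)"
    using S by (intro add.subgroupI) (auto simp: a_inv_def)
  then show "ideal S R"
    using S m_comm by (intro idealI ring_axioms) (auto simp: subset_iff)
next
  assume "ideal S R"
  then interpret S: ideal S R .
  show "S \<subseteq> carrier R" "S \<noteq> {}"
    using S.Icarr S.zero_closed by blast+
  show "\<forall>a\<in>S. \<forall>b\<in>S. a \<oplus> b \<in> S" "\<forall>a\<in>S. \<forall>r\<in>carrier R. r \<otimes> a \<in> S"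
    using S.a_closed S.I_l_closed by blast+
qed

lemmas ideal_zero_mem = additive_subgroup.zero_closed[OF ideal.axioms(1)]

lemma ideal_Int_eq_zero:
  assumes "ideal I R" "ideal J R" "I \<inter> J \<subseteq> {\<zero>\<^bsub>R\<^esub>}"
  shows "I \<inter> J = {\<zero>\<^bsub>R\<^esub>}"
  using assms ideal_zero_mem by blast

definition ideal_coz :: "'a topology \<Rightarrow> ('a \<Rightarrow> 'k::real_normed_field) set \<Rightarrow> 'a set" where
  "ideal_coz X K = (\<Union>h\<in>K. Coz X h)"

lemma mem_ideal_coz: "x \<in> ideal_coz X K \<longleftrightarrow> x \<in> topspace X \<and> (\<exists>h\<in>K. h x \<noteq> 0)"
  unfolding ideal_coz_def Coz_def by blast

lemma ideal_coz_mono: "K \<subseteq> J \<Longrightarrow> ideal_coz X K \<subseteq> ideal_coz X J"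
  unfolding ideal_coz_def by (intro Union_mono image_mono)

lemma openin_ideal_coz:
  assumes "K \<subseteq> carrier (CB X)"
  shows "openin X (ideal_coz X K)"
  unfolding ideal_coz_def
proof (rule openin_clauses(3), clarify)
  fix h assume "h \<in> K"
  then have "continuous_map X euclidean h"
    using assms mem_CB_iff by blast
  then show "openin X (Coz X h)"
    using openin_continuous_map_preimage[of X euclidean h "- {0}"] by (simp add: Coz_def open_Compl)
qed

lemma ideal_coz_eq_empty_iff:
  assumes "ideal K (CB X)"
  shows "ideal_coz X K = {} \<longleftrightarrow> K = {\<zero>\<^bsub>CB X\<^esub>}"
proof
  interpret ideal K "CB X" by fact
  show "K = {\<zero>\<^bsub>CB X\<^esub>}" if "ideal_coz X K = {}"
  proof -
    have "K \<subseteq> {\<zero>\<^bsub>CB X\<^esub>}"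
      using that CB_eq_zero_iff[OF Icarr] by (auto simp: set_eq_iff mem_ideal_coz)
    then show ?thesis
      using ideal_zero_mem[OF assms] by (metis empty_iff subset_singletonD)
  qed
qed (auto simp: ideal_coz_def Coz_def)

definition vanishing_off ::
    "('a \<Rightarrow> 'k::real_normed_field) set \<Rightarrow> 'a topology \<Rightarrow> 'a set \<Rightarrow> ('a \<Rightarrow> 'k) set" where
  "vanishing_off H X U = {h \<in> H. \<forall>x\<in>topspace X - U. h x = 0}"

lemma ideal_vanishing_off:
  assumes "ideal H (CB X)"
  shows "ideal (vanishing_off H X U) (CB X)"
proof -
  interpret cring "CB X" by (rule cring_CB)
  interpret H: ideal H "CB X" by fact
  have "\<zero>\<^bsub>CB X\<^esub> \<in> vanishing_off H X U"
    using H.zero_closed by (simp add: vanishing_off_def)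
  then have "vanishing_off H X U \<noteq> {}"
    by blast
  then show ?thesis
    unfolding ideal_iff_closed
    using H.Icarr H.a_closed H.I_l_closed by (auto simp: vanishing_off_def)
qed

text \<open>
  Vanishing at a point is a closed condition, since evaluation there is 1-Lipschitz for the
  supremum metric.
\<close>

lemma closed_ideal_vanishing_off:
  fixes H :: "('a \<Rightarrow> 'k::real_normed_field) set"
  assumes "closed_ideal H X"
  shows "closed_ideal (vanishing_off H X U) X"
proof -
  let ?m = "cfunspace X (euclidean_metric :: 'k metric)"
  let ?Z = "{h \<in> mspace ?m. \<forall>x\<in>topspace X - U. h x = 0}"
  interpret M: Metric_space "mspace ?m" "mdist ?m"
    by (rule Metric_space_mspace_mdist)
  have "closedin M.mtopology ?Z"
    unfolding M.closedin_metric
  proof (intro conjI allI impI)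
    fix f assume f: "f \<in> mspace ?m - ?Z"
    then obtain x where x: "x \<in> topspace X" "x \<notin> U" "f x \<noteq> 0"
      by blast
    have "norm (f x) \<le> mdist ?m f h" if "h \<in> ?Z" "h \<in> mspace ?m" for h
      using mdist_cfunspace_imp_mdist_le[of f X euclidean_metric h "mdist ?m f h" x] that f x
      by (auto simp: dist_norm)
    then have "disjnt ?Z (M.mball f (norm (f x)))"
      unfolding disjnt_iff M.in_mball by (meson not_le)
    then show "\<exists>r>0. disjnt ?Z (M.mball f r)"
      using x by (intro exI[of _ "norm (f x)"]) auto
  qed auto
  then have "closedin (mtopology_of ?m) (H \<inter> ?Z)"
    using assms unfolding closed_ideal_def mtopology_of_def by (intro closedin_Int) auto
  moreover have "H \<inter> ?Z = vanishing_off H X U"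
    using assms ideal.Icarr[of H "CB X"]
    unfolding closed_ideal_def vanishing_off_def CB_simps(1) by blast
  ultimately show ?thesis
    using assms ideal_vanishing_off unfolding closed_ideal_def by metis
qed

lemma CB_bump:
  assumes "completely_regular_space X" "openin X U" "x \<in> U"
  obtains u :: "'a \<Rightarrow> 'k::real_normed_field"
  where "u \<in> carrier (CB X)" "u x = 1" "\<And>y. y \<in> topspace X - U \<Longrightarrow> u y = 0"
proof -
  have x: "x \<in> topspace X"
    using assms openin_subset by blast
  then have "closedin X (topspace X - U)" "x \<in> topspace X - (topspace X - U)"
    using assms by auto
  then obtain f where f: "continuous_map X (top_of_set {0..1::real}) f" "f x = 0"
      "f ` (topspace X - U) \<subseteq> {1}"
    using assms(1) unfolding completely_regular_space_def by metis
  have fc: "continuous_map X euclidean f" and f01: "\<And>y. y \<in> topspace X \<Longrightarrow> f y \<in> {0..1}"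
    using f(1) unfolding continuous_map_in_subtopology by auto
  define u where "u = (\<lambda>y\<in>topspace X. of_real (1 - f y) :: 'k)"
  have "u \<in> carrier (CB X)"
    unfolding u_def
  proof (rule CB_memI)
    show "continuous_map X euclidean (\<lambda>y. of_real (1 - f y) :: 'k)"
      using fc by (simp add: continuous_map_atin tendsto_of_real tendsto_diff)
    show "bounded ((\<lambda>y. of_real (1 - f y) :: 'k) ` topspace X)"
      using f01 by (auto simp: bounded_iff norm_of_real simp del: of_real_diff intro!: exI[of _ 1])
  qed
  then show thesis
    using that[of u] f x unfolding u_def by fastforce
qed

text \<open>
  Multiplying an element of \<open>H\<close> by a bump function localises it in \<open>U\<close> without leaving \<open>H\<close>.
\<close>

lemma ideal_coz_vanishing_off:
  fixes H :: "('a \<Rightarrow> 'k::real_normed_field) set"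
  assumes "completely_regular_space X" "ideal H (CB X)" "openin X U"
  shows "ideal_coz X (vanishing_off H X U) = ideal_coz X H \<inter> U"
proof (intro subset_antisym subsetI)
  fix x assume "x \<in> ideal_coz X H \<inter> U"
  then obtain h where h: "h \<in> H" "h x \<noteq> 0" "x \<in> topspace X" "x \<in> U"
    by (auto simp: mem_ideal_coz)
  obtain u :: "'a \<Rightarrow> 'k"
    where u: "u \<in> carrier (CB X)" "u x = 1" "\<And>y. y \<in> topspace X - U \<Longrightarrow> u y = 0"
    using CB_bump[OF assms(1,3) h(4)] by blast
  have "u \<otimes>\<^bsub>CB X\<^esub> h \<in> vanishing_off H X U" "(u \<otimes>\<^bsub>CB X\<^esub> h) x \<noteq> 0"
    using h u ideal.I_l_closed[OF assms(2) h(1) u(1)] by (auto simp: vanishing_off_def)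
  then show "x \<in> ideal_coz X (vanishing_off H X U)"
    using h(3) unfolding mem_ideal_coz by blast
qed (auto simp: mem_ideal_coz vanishing_off_def)


section \<open>Essential subideals and direct summands\<close>

text \<open>
  If \<open>coz J\<close> is not contained in the closure of \<open>coz K\<close>, the elements of \<open>J\<close> vanishing
  on that closure form a nonzero ideal meeting \<open>K\<close> trivially.  Conversely, for a nonzero ideal \<open>L\<close> inside
  \<open>J\<close> the open set \<open>coz L\<close> meets \<open>coz K\<close>, so some element of \<open>L\<close> has a nonzero product with an
  element of \<open>K\<close>, and that product lies in \<open>K \<inter> L\<close>.
\<close>

lemma essential_subideal_iff:
  assumes X: "completely_regular_space X"
    and K: "ideal K (CB X)" "K \<noteq> {\<zero>\<^bsub>CB X\<^esub>}" and J: "ideal J (CB X)" and KJ: "K \<subseteq> J"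
  shows "essential_subideal K J (CB X) \<longleftrightarrow> ideal_coz X J \<subseteq> X closure_of (ideal_coz X K)"
proof
  interpret K: ideal K "CB X" by (rule K(1))
  interpret J: ideal J "CB X" by (rule J)
  let ?W = "topspace X - X closure_of (ideal_coz X K)"
  let ?L = "vanishing_off J X ?W"
  assume ess: "essential_subideal K J (CB X)"
  have L: "ideal ?L (CB X)"
    by (rule ideal_vanishing_off[OF J])
  have "h \<in> {\<zero>\<^bsub>CB X\<^esub>}" if "h \<in> K \<inter> ?L" for h
  proof -
    have h: "h \<in> K" "h \<in> ?L"
      using that by auto
    have "h x = 0" if x: "x \<in> topspace X" for x
    proof (rule ccontr)
      assume "h x \<noteq> 0"
      then have "x \<in> ideal_coz X K"
        using h(1) x unfolding mem_ideal_coz by blast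
      then have "x \<in> X closure_of (ideal_coz X K)"
        using closure_of_subset[OF openin_subset[OF openin_ideal_coz, of K X]] K.Icarr by blast
      then show False
        using h(2) x \<open>h x \<noteq> 0\<close> by (auto simp: vanishing_off_def)
    qed
    then show ?thesis
      using CB_eq_zero_iff K.Icarr[OF h(1)] by blast
  qed
  then have "K \<inter> ?L = {\<zero>\<^bsub>CB X\<^esub>}"
    by (intro ideal_Int_eq_zero[OF K(1) L] subsetI)
  then have "?L = {\<zero>\<^bsub>CB X\<^esub>}"
    using ess L unfolding essential_subideal_def subideal_def vanishing_off_def by blast
  moreover have "openin X ?W"
    by (rule openin_diff) auto
  ultimately have "ideal_coz X J \<inter> ?W = {}"
    using ideal_coz_eq_empty_iff[OF L] ideal_coz_vanishing_off[OF X J, of ?W] by auto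
  then show "ideal_coz X J \<subseteq> X closure_of (ideal_coz X K)"
    by (auto simp: mem_ideal_coz)
next
  interpret K: ideal K "CB X" by (rule K(1))
  assume sub: "ideal_coz X J \<subseteq> X closure_of (ideal_coz X K)"
  have "K \<inter> L \<noteq> {\<zero>\<^bsub>CB X\<^esub>}" if L: "ideal L (CB X)" "L \<subseteq> J" "L \<noteq> {\<zero>\<^bsub>CB X\<^esub>}" for L
  proof -
    interpret L: ideal L "CB X" by (rule L(1))
    have "openin X (ideal_coz X L)"
      by (rule openin_ideal_coz) (use L.Icarr in blast)
    moreover obtain x where x: "x \<in> ideal_coz X L"
      using ideal_coz_eq_empty_iff[OF L(1)] L(3) by blast
    moreover have "x \<in> ideal_coz X J"
      using x ideal_coz_mono[OF L(2)] by blast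
    then have "x \<in> X closure_of (ideal_coz X K)"
      using sub by blast
    ultimately obtain y where y: "y \<in> ideal_coz X K" "y \<in> ideal_coz X L"
      unfolding in_closure_of by blast
    then obtain k l where kl: "k \<in> K" "l \<in> L" "k y \<noteq> 0" "l y \<noteq> 0" "y \<in> topspace X"
      unfolding mem_ideal_coz by blast
    have "k \<otimes>\<^bsub>CB X\<^esub> l \<in> K \<inter> L"
      using K.I_r_closed[OF kl(1) L.Icarr[OF kl(2)]] L.I_l_closed[OF kl(2) K.Icarr[OF kl(1)]]
      by (rule IntI)
    moreover have "k \<otimes>\<^bsub>CB X\<^esub> l \<noteq> \<zero>\<^bsub>CB X\<^esub>"
      using kl by (auto simp: fun_eq_iff)
    ultimately show ?thesis
      by blast
  qed
  then show "essential_subideal K J (CB X)"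
    using K KJ by (simp add: essential_subideal_def subideal_def del: CB_simps)
qed

text \<open>
  A complement \<open>I\<close> of \<open>J\<close> in \<open>H\<close> has as its cozero-set exactly the topological complement of
  that of \<open>J\<close>: disjointness comes from \<open>I J \<subseteq> I \<inter> J\<close>, covering from \<open>H = I + J\<close>
  and the fact that \<open>H\<close> vanishes nowhere.
\<close>

lemma direct_summand_coz_clopen:
  assumes "non_vanishing H X" "direct_summand J H (CB X)"
  shows "openin X (ideal_coz X J)" "closedin X (ideal_coz X J)"
proof -
  obtain I where I: "subideal I H (CB X)"
      and H: "H = I <+>\<^bsub>CB X\<^esub> J" and IJ: "I \<inter> J = {\<zero>\<^bsub>CB X\<^esub>}"
    using assms(2) unfolding direct_summand_def by (elim conjE exE)
  interpret I: ideal I "CB X"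
    using I unfolding subideal_def by (rule conjunct1)
  interpret J: ideal J "CB X"
    using assms(2) unfolding direct_summand_def subideal_def by (elim conjE)
  show J: "openin X (ideal_coz X J)"
    by (rule openin_ideal_coz) (use J.Icarr in blast)
  have I: "openin X (ideal_coz X I)"
    by (rule openin_ideal_coz) (use I.Icarr in blast)
  have "x \<notin> ideal_coz X J" if xI: "x \<in> ideal_coz X I" for x
  proof
    assume xJ: "x \<in> ideal_coz X J"
    obtain i where i: "i \<in> I" "i x \<noteq> 0"
      using xI unfolding mem_ideal_coz by metis
    obtain j where j: "j \<in> J" "j x \<noteq> 0" "x \<in> topspace X"
      using xJ unfolding mem_ideal_coz by metis
    note ij = i(1) j(1)
    have "i \<otimes>\<^bsub>CB X\<^esub> j \<in> I \<inter> J"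
      using I.I_r_closed[OF ij(1) J.Icarr[OF ij(2)]] J.I_l_closed[OF ij(2) I.Icarr[OF ij(1)]]
      by (rule IntI)
    then have "i \<otimes>\<^bsub>CB X\<^esub> j = \<zero>\<^bsub>CB X\<^esub>"
      unfolding IJ by (rule singletonD)
    then have "i x * j x = 0"
      using j(3) by (auto simp: fun_eq_iff split: if_splits)
    then show False
      using i(2) j(2) by simp
  qed
  moreover have "x \<in> ideal_coz X I \<union> ideal_coz X J" if x: "x \<in> topspace X" for x
  proof -
    obtain h where "h \<in> H" "h x \<noteq> 0"
      using assms(1) x unfolding non_vanishing_def by blast
    then obtain i j where "i \<in> I" "j \<in> J" "i x + j x \<noteq> 0"
      using x unfolding H set_add_def' by auto
    then have "i x \<noteq> 0 \<and> i \<in> I \<or> j x \<noteq> 0 \<and> j \<in> J"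
      by auto
    then show ?thesis
      using x unfolding Un_iff mem_ideal_coz by blast
  qed
  ultimately have "topspace X - ideal_coz X J = ideal_coz X I"
    using openin_subset[OF I] by blast
  then show "closedin X (ideal_coz X J)"
    using I openin_subset[OF J] unfolding closedin_def by simp
qed

lemma direct_summand_vanishing_off:
  fixes H :: "('a \<Rightarrow> 'k::real_normed_field) set"
  assumes H: "ideal H (CB X)" and V: "openin X V" "closedin X V"
  shows "direct_summand (vanishing_off H X V) H (CB X)"
proof -
  interpret H: ideal H "CB X" by (rule H)
  let ?I = "vanishing_off H X (topspace X - V)" and ?J = "vanishing_off H X V"
  let ?u = "\<lambda>x\<in>topspace X. if x \<in> topspace X - V then 1 else 0 :: 'k"
  let ?v = "\<lambda>x\<in>topspace X. if x \<in> V then 1 else 0 :: 'k"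
  note I = ideal_vanishing_off[OF H, of "topspace X - V"]
  note J = ideal_vanishing_off[OF H, of V]
  have "H = ?I <+>\<^bsub>CB X\<^esub> ?J"
  proof (intro subset_antisym subsetI)
    fix h assume h: "h \<in> H"
    have "?u \<otimes>\<^bsub>CB X\<^esub> h \<in> H" "?v \<otimes>\<^bsub>CB X\<^esub> h \<in> H"
      using H.I_l_closed[OF h] CB_indicator[of X V] CB_indicator[of X "topspace X - V"] V
      by blast+
    then have "?u \<otimes>\<^bsub>CB X\<^esub> h \<in> ?I" "?v \<otimes>\<^bsub>CB X\<^esub> h \<in> ?J"
      by (auto simp: vanishing_off_def)
    moreover have "h = (?u \<otimes>\<^bsub>CB X\<^esub> h) \<oplus>\<^bsub>CB X\<^esub> (?v \<otimes>\<^bsub>CB X\<^esub> h)"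
      using H.Icarr[OF h] unfolding mem_CB_iff by (auto simp: fun_eq_iff extensional_def)
    ultimately show "h \<in> ?I <+>\<^bsub>CB X\<^esub> ?J"
      unfolding set_add_def' by blast
  next
    fix h assume "h \<in> ?I <+>\<^bsub>CB X\<^esub> ?J"
    then obtain i j where "i \<in> H" "j \<in> H" "h = i \<oplus>\<^bsub>CB X\<^esub> j"
      unfolding set_add_def' vanishing_off_def by blast
    then show "h \<in> H"
      using H.a_closed by blast
  qed
  moreover have "?I \<inter> ?J = {\<zero>\<^bsub>CB X\<^esub>}"
  proof (rule ideal_Int_eq_zero[OF I J], rule subsetI)
    fix h assume h: "h \<in> ?I \<inter> ?J"
    then have "h \<in> H" "\<forall>x\<in>topspace X. h x = 0"
      by (auto simp: vanishing_off_def)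
    then show "h \<in> {\<zero>\<^bsub>CB X\<^esub>}"
      using CB_eq_zero_iff[OF H.Icarr, of h] by blast
  qed
  moreover have "subideal ?I H (CB X)" "subideal ?J H (CB X)"
    using I J unfolding subideal_def by (auto simp: vanishing_off_def)
  ultimately show ?thesis
    unfolding direct_summand_def by blast
qed


section \<open>The equivalence\<close>

lemma extremally_disconnected_iff_essential_in_summand:
  fixes H :: "('a \<Rightarrow> 'k::real_normed_field) set"
  assumes X: "completely_regular_space X" and H: "closed_ideal H X" "non_vanishing H X"
  shows "extremally_disconnected X \<longleftrightarrow>
     (\<forall>K. closed_ideal K X \<and> K \<subseteq> H \<and> K \<noteq> {\<zero>\<^bsub>CB X\<^esub>} \<longrightarrow>
        (\<exists>J. direct_summand J H (CB X) \<and> essential_subideal K J (CB X)))"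
    (is "_ \<longleftrightarrow> ?R")
proof
  have iH: "ideal H (CB X)"
    using H(1) by (simp add: closed_ideal_def)
  show ?R if ed: "extremally_disconnected X"
  proof (intro allI impI)
    fix K assume K: "closed_ideal K X \<and> K \<subseteq> H \<and> K \<noteq> {\<zero>\<^bsub>CB X\<^esub>}"
    then have iK: "ideal K (CB X)"
      by (simp add: closed_ideal_def)
    let ?V = "X closure_of (ideal_coz X K)"
    let ?J = "vanishing_off H X ?V"
    have open_coz: "openin X (ideal_coz X K)"
      by (rule openin_ideal_coz) (use ideal.Icarr[OF iK] in blast)
    have V: "openin X ?V" "closedin X ?V"
      using ed open_coz unfolding extremally_disconnected_def by auto
    have "K \<subseteq> ?J"
      using K closure_of_subset[OF openin_subset[OF open_coz]]
      by (auto simp: vanishing_off_def mem_ideal_coz subset_iff)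
    moreover have "ideal_coz X ?J \<subseteq> ?V"
      by (auto simp: mem_ideal_coz vanishing_off_def)
    ultimately have "essential_subideal K ?J (CB X)"
      using essential_subideal_iff[OF X iK _ ideal_vanishing_off[OF iH]] K by blast
    then show "\<exists>J. direct_summand J H (CB X) \<and> essential_subideal K J (CB X)"
      using direct_summand_vanishing_off[OF iH V] by blast
  qed
  show "extremally_disconnected X" if R: ?R
    unfolding extremally_disconnected_def
  proof (intro allI impI)
    fix U assume U: "openin X U"
    \<comment> \<open>With \<open>coz K = U\<close> and \<open>K\<close> essential in the summand \<open>J\<close>, the clopen set \<open>coz J\<close> contains \<open>U\<close>
      and is contained in its closure.\<close>
    show "openin X (X closure_of U)"
    proof (cases "U = {}")
      case False
      let ?K = "vanishing_off H X U"
      have K: "closed_ideal ?K X" "ideal ?K (CB X)"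
        using closed_ideal_vanishing_off[OF H(1)] ideal_vanishing_off[OF iH] by auto
      have "ideal_coz X H = topspace X"
        using H(2) by (auto simp: mem_ideal_coz non_vanishing_def)
      then have cozK: "ideal_coz X ?K = U"
        using ideal_coz_vanishing_off[OF X iH U] openin_subset[OF U] by auto
      then have K0: "?K \<noteq> {\<zero>\<^bsub>CB X\<^esub>}"
        using False ideal_coz_eq_empty_iff[OF K(2)] by auto
      moreover have "?K \<subseteq> H"
        by (auto simp: vanishing_off_def)
      ultimately obtain J where J: "direct_summand J H (CB X)" "essential_subideal ?K J (CB X)"
        using R K(1) by blast
      then have KJ: "?K \<subseteq> J" and iJ: "ideal J (CB X)"
        unfolding essential_subideal_def direct_summand_def subideal_def by auto
      note clopen = direct_summand_coz_clopen[OF H(2) J(1)]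
      have "ideal_coz X J \<subseteq> X closure_of U"
        using essential_subideal_iff[OF X K(2) K0 iJ KJ] J(2) cozK by simp
      moreover have "ideal_coz X ?K \<subseteq> ideal_coz X J"
        using KJ by (rule ideal_coz_mono)
      then have "U \<subseteq> ideal_coz X J"
        unfolding cozK .
      then have "X closure_of U \<subseteq> ideal_coz X J"
        using clopen(2) by (rule closure_of_minimal)
      ultimately show ?thesis
        using clopen(1) by simp
    qed simp
  qed
qed

theorem theorem4p12:
  fixes X :: "'a topology"
  assumes "completely_regular_space X" and "Hausdorff_space X"
  shows
    "(\<forall>H :: ('a \<Rightarrow> real) set. closed_ideal H X \<and> non_vanishing H X \<longrightarrow>
        (extremally_disconnected (spectrum H X) \<longleftrightarrow>
         (\<forall>K. closed_ideal K X \<and> K \<subseteq> H \<and> K \<noteq> {\<zero>\<^bsub>CB X\<^esub>} \<longrightarrow>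
            (\<exists>J. direct_summand J H (CB X) \<and> essential_subideal K J (CB X))))) \<and>
     (\<forall>H :: ('a \<Rightarrow> complex) set. closed_ideal H X \<and> non_vanishing H X \<longrightarrow>
        (extremally_disconnected (spectrum H X) \<longleftrightarrow>
         (\<forall>K. closed_ideal K X \<and> K \<subseteq> H \<and> K \<noteq> {\<zero>\<^bsub>CB X\<^esub>} \<longrightarrow>
            (\<exists>J. direct_summand J H (CB X) \<and> essential_subideal K J (CB X)))))"
proof (intro conjI allI impI; elim conjE)
  fix H :: "('a \<Rightarrow> real) set"
  assume "closed_ideal H X" "non_vanishing H X"
  then show "extremally_disconnected (spectrum H X) \<longleftrightarrow>
      (\<forall>K. closed_ideal K X \<and> K \<subseteq> H \<and> K \<noteq> {\<zero>\<^bsub>CB X\<^esub>} \<longrightarrow>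
        (\<exists>J. direct_summand J H (CB X) \<and> essential_subideal K J (CB X)))"
    using extremally_disconnected_spectrum_iff[OF assms, of H]
      extremally_disconnected_iff_essential_in_summand[OF assms(1), of H]
    unfolding closed_ideal_def by simp
next
  fix H :: "('a \<Rightarrow> complex) set"
  assume "closed_ideal H X" "non_vanishing H X"
  then show "extremally_disconnected (spectrum H X) \<longleftrightarrow>
      (\<forall>K. closed_ideal K X \<and> K \<subseteq> H \<and> K \<noteq> {\<zero>\<^bsub>CB X\<^esub>} \<longrightarrow>
        (\<exists>J. direct_summand J H (CB X) \<and> essential_subideal K J (CB X)))"
    using extremally_disconnected_spectrum_iff[OF assms, of H]
      extremally_disconnected_iff_essential_in_summand[OF assms(1), of H]
    unfolding closed_ideal_def by simp
qed

end
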